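(* Let $\mathcal{F}$ be a non-degenerate pencil of conics in $\mathbb{C}P^2$ and let $\Gamma_1,\Gamma_2,\Gamma_3,\Gamma_4$ be four conics in $\mathcal{F}$. Consider a line $d$ passing through one of the base points of the pencil $\mathcal{F}$. Denote by $M_i$ the second intersection of $d$ with $\Gamma_i$ ($i=1,2,3,4$). Then $$(\Gamma_1,\Gamma_2,\Gamma_3,\Gamma_4)=(M_1,M_2,M_3,M_4).$$
   Context: We work in $\mathbb{C}P^2$. Let $Q(\mathbb{C}^3)$ denote the space of quadratic forms on $\mathbb{C}^3$; up to scalar, these are considered as conics (possibly degenerate). A pencil of conics is a line in the projective space $\mathbb{P}(Q(\mathbb{C}^3))$: the pencil generated by two conics with equations $E_1=0$ and $E_2=0$ consists of all conics with equation $\lambda E_1+\mu E_2=0$. The pencil is non-degenerate if two conics generating it meet in four distinct points, called the base points of the pencil; a conic belongs to the pencil if and only if it passes through the four base points. The cross ratio of four points on a line is, in terms of a coordinate on the line, $(A,B,C,D)=\frac{(A-C)(B-D)}{(B-C)(A-D)}$. The cross ratio $(\Gamma_1,\Gamma_2,\Gamma_3,\Gamma_4)$ of four conics in a pencil is their cross ratio as points of the projective line in $\mathbb{P}(Q(\mathbb{C}^3))$ which is the pencil. *)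

theory Defs
  imports "HOL-Analysis.Analysis" "HOL-Library.Function_Algebras"
begin

section \<open>Projective geometry in a vector space\<close>

text \<open>
  The points of the projective space of a vector space are its one-dimensional subspaces, the
  projective lines are its two-dimensional subspaces; a point lies on a line if it is contained
  in it, so that the set of points of a line \<open>L\<close> is again \<open>projective_points L\<close>.
\<close>

datatype 'a extended = Finite 'a | Infinity

text \<open>
  The quotient \<open>n / d\<close> as a point of the projective line over the field;
  \<open>0 / 0\<close> is undefined (\<open>None\<close>).
\<close>

definition extended_quotient :: "'a::field \<Rightarrow> 'a \<Rightarrow> 'a extended option" where
  "extended_quotient n d =
     (if d \<noteq> 0 then Some (Finite (n / d)) else if n \<noteq> 0 then Some Infinity else None)"

definition bracket :: "'a::field \<times> 'a \<Rightarrow> 'a \<times> 'a \<Rightarrow> 'a" where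
  "bracket a b = fst a * snd b - fst b * snd a"

lemma extended_quotient_mult:
  "k \<noteq> 0 \<Longrightarrow> extended_quotient (k * n) (k * d) = extended_quotient n d"
  by (auto simp: extended_quotient_def)

locale projective_space = vector_space scale
  for scale :: "'a::field \<Rightarrow> 'b::ab_group_add \<Rightarrow> 'b"
begin

definition projective_points :: "'b set \<Rightarrow> 'b set set" where
  "projective_points V = {span {v} | v. v \<in> V \<and> v \<noteq> 0}"

definition projective_lines :: "'b set \<Rightarrow> 'b set set" where
  "projective_lines V = {L. subspace L \<and> L \<subseteq> V \<and> dim L = 2}"

definition homogeneous_coordinates :: "'b \<Rightarrow> 'b \<Rightarrow> 'b set \<Rightarrow> 'a \<times> 'a \<Rightarrow> bool" where
  "homogeneous_coordinates e f X a \<longleftrightarrow>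
     a \<noteq> (0, 0) \<and> X = span {scale (fst a) e + scale (snd a) f}"

text \<open>
  A coordinate on the line spanned by \<open>e\<close> and \<open>f\<close> sends the point with homogeneous coordinates
  \<open>(x, y)\<close> to \<open>x / y\<close>, which is infinite if \<open>y = 0\<close>. Clearing denominators in
  \<open>(A - C) (B - D) / ((B - C) (A - D))\<close> yields the quotient below, which makes sense also when one
  of the points is at infinity. It is undefined (\<open>None\<close>) precisely if three of the points coincide,
  and otherwise infinite precisely if \<open>B = C\<close> or \<open>A = D\<close>. It does not depend on the choice of \<open>e\<close>
  and \<open>f\<close> (\<open>cross_ratio_eq\<close> below).
\<close>

definition cross_ratio :: "'b set \<Rightarrow> 'b set \<Rightarrow> 'b set \<Rightarrow> 'b set \<Rightarrow> 'a extended option" where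
  "cross_ratio A B C D =
     (THE r. \<exists>e f a b c d. e \<noteq> f \<and> independent {e, f} \<and>
        homogeneous_coordinates e f A a \<and> homogeneous_coordinates e f B b \<and>
        homogeneous_coordinates e f C c \<and> homogeneous_coordinates e f D d \<and>
        r = extended_quotient (bracket a c * bracket b d) (bracket b c * bracket a d))"

lemma independent_pair:
  assumes "e \<noteq> f" "independent {e, f}" "scale x e + scale y f = 0"
  shows "x = 0 \<and> y = 0"
proof -
  let ?u = "\<lambda>v. if v = e then x else y"
  have s: "(\<Sum>v\<in>{e,f}. scale (?u v) v) = 0" using assms(1,3) by simp
  have "?u v = 0" if "v \<in> {e, f}" for v
    by (rule independentD[OF assms(2) _ subset_refl s that]) simp
  from this[of e] this[of f] show ?thesis using assms(1) by simp
qed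

lemma independent_pair_eq:
  assumes "e \<noteq> f" "independent {e, f}" "scale x e + scale y f = scale x' e + scale y' f"
  shows "x = x' \<and> y = y'"
proof -
  have "scale (x - x') e + scale (y - y') f = 0"
    using assms(3) by (simp add: scale_left_diff_distrib algebra_simps)
  from independent_pair[OF assms(1,2) this] show ?thesis by simp
qed

lemma homogeneous_coordinates_proportional:
  assumes "e \<noteq> f" "independent {e, f}" 
    and "homogeneous_coordinates e f A a" 
    and "scale x e + scale y f \<in> A"
  shows "\<exists>k. x = k * fst a \<and> y = k * snd a"
proof -
  obtain k where "scale x e + scale y f = scale k (scale (fst a) e + scale (snd a) f)"
    using assms(3,4) by (auto simp: homogeneous_coordinates_def span_singleton)
  then have "scale x e + scale y f = scale (k * fst a) e + scale (k * snd a) f"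
    by (simp add: scale_right_distrib)
  from independent_pair_eq[OF assms(1,2) this] show ?thesis by blast
qed

lemma bracket_eq_0_iff:
  assumes "e \<noteq> f" "independent {e, f}" 
    and "homogeneous_coordinates e f A a" "homogeneous_coordinates e f B b" 
  shows "bracket a b = 0 \<longleftrightarrow> A = B"
proof
  assume "A = B"
  then have "scale (fst a) e + scale (snd a) f \<in> B"
    using assms(3) by (auto simp: homogeneous_coordinates_def intro: span_base)
  from homogeneous_coordinates_proportional[OF assms(1,2,4) this]
  show "bracket a b = 0" by (auto simp: bracket_def)
next
  assume br: "bracket a b = 0"
  have nz: "a \<noteq> (0,0)" "b \<noteq> (0,0)" using assms by (auto simp: homogeneous_coordinates_def)
  obtain k where k: "k \<noteq> 0" "fst a = k * fst b" "snd a = k * snd b"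
  proof (cases "fst b = 0")
    case True
    then have "snd b \<noteq> 0" using nz by (metis prod.collapse)
    moreover have "fst a = 0" using br True \<open>snd b \<noteq> 0\<close> by (simp add: bracket_def)
    moreover have "snd a \<noteq> 0" using nz \<open>fst a = 0\<close> by (metis prod.collapse)
    ultimately show ?thesis using that[of "snd a / snd b"] True by simp
  next
    case False
    have "fst a \<noteq> 0"
    proof
      assume "fst a = 0"
      then have "snd a = 0" using br False by (simp add: bracket_def)
      with \<open>fst a = 0\<close> nz show False by (metis prod.collapse)
    qed
    then show ?thesis using that[of "fst a / fst b"] False br
      by (simp add: bracket_def field_simps)
  qed
  have "scale (fst a) e + scale (snd a) f = scale k (scale (fst b) e + scale (snd b) f)"
    using k by (simp add: scale_right_distrib)
  then have "span {scale (fst a) e + scale (snd a) f} = span {scale (fst b) e + scale (snd b) f}"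
    using k(1) by (simp add: span_image_scale[of "{scale (fst b) e + scale (snd b) f}" "\<lambda>_. k", simplified])
  then show "A = B" using assms(3,4) by (simp add: homogeneous_coordinates_def)
qed

lemma cross_ratio_independent_aux:
  assumes "e \<noteq> f" "independent {e, f}"
    "homogeneous_coordinates e f A a" "homogeneous_coordinates e f B b"
    "homogeneous_coordinates e f C c" "homogeneous_coordinates e f D d"
  assumes "e' \<noteq> f'" "independent {e', f'}"
    "homogeneous_coordinates e' f' A a'" "homogeneous_coordinates e' f' B b'"
    "homogeneous_coordinates e' f' C c'" "homogeneous_coordinates e' f' D d'"
  assumes "X \<in> {A,B,C,D}" "Y \<in> {A,B,C,D}" "X \<noteq> Y"
  shows "extended_quotient (bracket a c * bracket b d) (bracket b c * bracket a d) =
         extended_quotient (bracket a' c' * bracket b' d') (bracket b' c' * bracket a' d')"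
proof -
  let ?h = "homogeneous_coordinates e f" and ?h' = "homogeneous_coordinates e' f'"
  have "\<exists>z z'. ?h Z z \<and> ?h' Z z'" if "Z \<in> {A,B,C,D}" for Z
    using that assms(3-6,9-12) by (auto simp del: split_paired_Ex)
  from this[OF assms(13)] this[OF assms(14)]
  obtain x y x' y' where xy: "?h X x" "?h Y y" "?h' X x'" "?h' Y y'" by blast
  have sub: "Z \<subseteq> span {e', f'}" if "?h' Z z" for Z z
  proof -
    have "scale (fst z) e' + scale (snd z) f' \<in> span {e', f'}"
      by (intro span_add span_scale span_base) auto
    then show ?thesis using that span_minimal[of "{scale (fst z) e' + scale (snd z) f'}" "span {e',f'}"]
      by (auto simp: homogeneous_coordinates_def)
  qed
  have mem: "scale (fst z) e + scale (snd z) f \<in> Z" if "?h Z z" for Z z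
    using that by (auto simp: homogeneous_coordinates_def intro: span_base)
  define \<delta> where "\<delta> = bracket x y"
  have \<delta>: "\<delta> \<noteq> 0" using bracket_eq_0_iff[OF assms(1,2) xy(1,2)] assms(15) by (simp add: \<delta>_def)
  define v where "v = scale (fst x) e + scale (snd x) f"
  define w where "w = scale (fst y) e + scale (snd y) f"
  have vw: "v \<in> span {e',f'}" "w \<in> span {e',f'}"
    using mem[OF xy(1)] mem[OF xy(2)] sub[OF xy(3)] sub[OF xy(4)] by (auto simp: v_def w_def)
  have "scale \<delta> e = scale (snd y) v - scale (snd x) w"
    unfolding v_def w_def \<delta>_def bracket_def
    by (simp add: scale_right_distrib scale_left_diff_distrib mult.commute)
  then have "scale \<delta> e \<in> span {e',f'}" using vw by (simp add: span_diff span_scale)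
  then have "scale (inverse \<delta>) (scale \<delta> e) \<in> span {e',f'}" by (rule span_scale)
  then have "e \<in> span {e',f'}" using \<delta> by simp
  then obtain p q where e: "e = scale p e' + scale q f'"
    by (auto simp: span_breakdown_eq span_singleton algebra_simps)
  have "scale \<delta> f = scale (fst x) w - scale (fst y) v"
    unfolding v_def w_def \<delta>_def bracket_def
    by (simp add: scale_right_distrib scale_left_diff_distrib mult.commute)
  then have "scale \<delta> f \<in> span {e',f'}" using vw by (simp add: span_diff span_scale)
  then have "scale (inverse \<delta>) (scale \<delta> f) \<in> span {e',f'}" by (rule span_scale)
  then have "f \<in> span {e',f'}" using \<delta> by simp
  then obtain r s where f: "f = scale r e' + scale s f'"
    by (auto simp: span_breakdown_eq span_singleton algebra_simps)
  have tr: "\<exists>k. fst z * p + snd z * r = k * fst z' \<and> fst z * q + snd z * s = k * snd z' \<and> k \<noteq> 0"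
    if "?h Z z" "?h' Z z'" for Z z z'
  proof -
    have "scale (fst z) e + scale (snd z) f =
       scale (fst z * p + snd z * r) e' + scale (fst z * q + snd z * s) f'"
      by (simp add: e f scale_right_distrib scale_left_distrib algebra_simps)
    with mem[OF that(1)] have "scale (fst z * p + snd z * r) e' + scale (fst z * q + snd z * s) f' \<in> Z"
      by simp
    from homogeneous_coordinates_proportional[OF assms(7,8) that(2) this]
    obtain k where k: "fst z * p + snd z * r = k * fst z'" "fst z * q + snd z * s = k * snd z'" by blast
    have "k \<noteq> 0"
    proof
      assume "k = 0"
      then have "scale (fst z) e + scale (snd z) f = 0"
        using k \<open>scale (fst z) e + scale (snd z) f = _\<close> by simp
      from independent_pair[OF assms(1,2) this] that(1) show False
        by (cases z) (auto simp: homogeneous_coordinates_def)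
    qed
    then show ?thesis using k by blast
  qed
  have br: "bracket (fst z * p + snd z * r, fst z * q + snd z * s)
      (fst z' * p + snd z' * r, fst z' * q + snd z' * s) = (p * s - q * r) * bracket z z'" for z z'
    by (simp add: bracket_def algebra_simps)
  have brk: "(p * s - q * r) * bracket z1 z2 = k * l * bracket z1' z2'"
    if "fst z1 * p + snd z1 * r = k * fst z1'" "fst z1 * q + snd z1 * s = k * snd z1'"
       "fst z2 * p + snd z2 * r = l * fst z2'" "fst z2 * q + snd z2 * s = l * snd z2'"
    for z1 z2 z1' z2' k l
    unfolding br[symmetric] that by (simp add: bracket_def algebra_simps)
  obtain ka where ka: "fst a * p + snd a * r = ka * fst a'"
      "fst a * q + snd a * s = ka * snd a'" "ka \<noteq> 0"
    using tr[OF assms(3,9)] by blast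
  obtain kb where kb: "fst b * p + snd b * r = kb * fst b'"
      "fst b * q + snd b * s = kb * snd b'" "kb \<noteq> 0"
    using tr[OF assms(4,10)] by blast
  obtain kc where kc: "fst c * p + snd c * r = kc * fst c'"
      "fst c * q + snd c * s = kc * snd c'" "kc \<noteq> 0"
    using tr[OF assms(5,11)] by blast
  obtain kd where kd: "fst d * p + snd d * r = kd * fst d'"
      "fst d * q + snd d * s = kd * snd d'" "kd \<noteq> 0"
    using tr[OF assms(6,12)] by blast
  obtain kx where kx: "fst x * p + snd x * r = kx * fst x'"
      "fst x * q + snd x * s = kx * snd x'" "kx \<noteq> 0"
    using tr[OF xy(1,3)] by blast
  obtain ky where ky: "fst y * p + snd y * r = ky * fst y'"
      "fst y * q + snd y * s = ky * snd y'" "ky \<noteq> 0"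
    using tr[OF xy(2,4)] by blast
  have "bracket x' y' \<noteq> 0" using bracket_eq_0_iff[OF assms(7,8) xy(3,4)] assms(15) by simp
  then have det: "p * s - q * r \<noteq> 0" using brk[OF kx(1,2) ky(1,2)] kx ky by auto
  let ?D = "(p * s - q * r) ^ 2" and ?K = "ka * kb * kc * kd"
  have "extended_quotient (bracket a c * bracket b d) (bracket b c * bracket a d) =
     extended_quotient (?D * (bracket a c * bracket b d)) (?D * (bracket b c * bracket a d))"
    using det by (simp add: extended_quotient_mult)
  also have "?D * (bracket a c * bracket b d) = ((p * s - q * r) * bracket a c) * ((p * s - q * r) * bracket b d)"
    by (simp add: power2_eq_square mult_ac)
  also have "\<dots> = ?K * (bracket a' c' * bracket b' d')"
    unfolding brk[OF ka(1,2) kc(1,2)] brk[OF kb(1,2) kd(1,2)] by (simp only: mult_ac)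
  also have "?D * (bracket b c * bracket a d) = ((p * s - q * r) * bracket b c) * ((p * s - q * r) * bracket a d)"
    by (simp add: power2_eq_square mult_ac)
  also have "\<dots> = ?K * (bracket b' c' * bracket a' d')"
    unfolding brk[OF kb(1,2) kc(1,2)] brk[OF ka(1,2) kd(1,2)] by (simp only: mult_ac)
  also have "extended_quotient (?K * (bracket a' c' * bracket b' d')) (?K * (bracket b' c' * bracket a' d'))
     = extended_quotient (bracket a' c' * bracket b' d') (bracket b' c' * bracket a' d')"
    using ka kb kc kd by (simp add: extended_quotient_mult)
  finally show ?thesis .
qed

lemma cross_ratio_eq:
  assumes "e \<noteq> f" "independent {e, f}"
    "homogeneous_coordinates e f A a" "homogeneous_coordinates e f B b"
    "homogeneous_coordinates e f C c" "homogeneous_coordinates e f D d"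
  shows "cross_ratio A B C D =
    extended_quotient (bracket a c * bracket b d) (bracket b c * bracket a d)"
  unfolding cross_ratio_def
proof (rule the_equality)
  show "\<exists>e f a' b' c' d'. e \<noteq> f \<and> independent {e, f} \<and>
        homogeneous_coordinates e f A a' \<and> homogeneous_coordinates e f B b' \<and>
        homogeneous_coordinates e f C c' \<and> homogeneous_coordinates e f D d' \<and>
        extended_quotient (bracket a c * bracket b d) (bracket b c * bracket a d) =
        extended_quotient (bracket a' c' * bracket b' d') (bracket b' c' * bracket a' d')"
    by (intro exI conjI) (rule assms refl)+
next
  fix t
  assume "\<exists>e f a b c d. e \<noteq> f \<and> independent {e, f} \<and>
        homogeneous_coordinates e f A a \<and> homogeneous_coordinates e f B b \<and>
        homogeneous_coordinates e f C c \<and> homogeneous_coordinates e f D d \<and>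
        t = extended_quotient (bracket a c * bracket b d) (bracket b c * bracket a d)"
  then show "t = extended_quotient (bracket a c * bracket b d) (bracket b c * bracket a d)"
  proof (elim exE conjE)
    fix e' f' a' b' c' d'
    assume *: "e' \<noteq> f'" "independent {e', f'}"
      "homogeneous_coordinates e' f' A a'" "homogeneous_coordinates e' f' B b'"
      "homogeneous_coordinates e' f' C c'" "homogeneous_coordinates e' f' D d'"
      and t: "t = extended_quotient (bracket a' c' * bracket b' d') (bracket b' c' * bracket a' d')"
    show ?thesis
  proof (cases "A = B \<and> A = C \<and> A = D")
    case True
    then have "bracket a c = 0" "bracket b c = 0" "bracket a' c' = 0" "bracket b' c' = 0"
      using bracket_eq_0_iff[OF assms(1,2,3,5)] bracket_eq_0_iff[OF assms(1,2,4,5)]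
        bracket_eq_0_iff[OF *(1,2,3,5)] bracket_eq_0_iff[OF *(1,2,4,5)] by auto
    then show ?thesis by (simp add: t)
  next
    case False
    then obtain Y where Y: "Y \<in> {A,B,C,D}" "A \<noteq> Y" by blast
    show ?thesis unfolding t
      by (rule cross_ratio_independent_aux[OF * assms _ Y]) simp
  qed
  qed
qed

lemma cross_ratio_affine:
  assumes ef: "e \<noteq> f" "independent {e, f}" and "r \<noteq> s" "p \<noteq> t"
  defines "X \<equiv> \<lambda>x. span {scale x e + f}"
  shows "cross_ratio (X p) (X r) (X s) (X t) =
    Some (Finite ((p - s) * (r - t) / ((r - s) * (p - t))))"
proof -
  have "homogeneous_coordinates e f (X x) (x, 1)" for x
    by (simp add: homogeneous_coordinates_def X_def)
  from cross_ratio_eq[OF ef this this this this, of p r s t] show ?thesis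
    using assms(3,4) by (simp add: extended_quotient_def bracket_def)
qed

end

section \<open>Conics and pencils of conics\<close>

definition quadratic_forms :: "(complex ^ 3 \<Rightarrow> complex) set" where
  "quadratic_forms =
     {q. \<exists>A :: complex ^ 3 ^ 3. \<forall>v. q v = (\<Sum>i\<in>UNIV. \<Sum>j\<in>UNIV. A $ i $ j * v $ i * v $ j)}"

definition form_scale :: "complex \<Rightarrow> (complex ^ 3 \<Rightarrow> complex) \<Rightarrow> complex ^ 3 \<Rightarrow> complex" where
  "form_scale c q = (\<lambda>v. c * q v)"

global_interpretation forms: projective_space form_scale
  by unfold_locales (auto simp: form_scale_def fun_eq_iff algebra_simps)

global_interpretation plane: projective_space "(*s) :: complex \<Rightarrow> complex ^ 3 \<Rightarrow> complex ^ 3"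
  by unfold_locales

lemma subspace_quadratic_forms: "forms.subspace quadratic_forms"
proof -
  have "0 \<in> quadratic_forms"
    unfolding quadratic_forms_def by (auto intro!: exI[of _ 0])
  moreover have "p + q \<in> quadratic_forms" if pq: "p \<in> quadratic_forms" "q \<in> quadratic_forms" for p q
  proof -
    obtain A B :: "complex ^ 3 ^ 3" where
      "\<And>v. p v = (\<Sum>i\<in>UNIV. \<Sum>j\<in>UNIV. A $ i $ j * v $ i * v $ j)"
      "\<And>v. q v = (\<Sum>i\<in>UNIV. \<Sum>j\<in>UNIV. B $ i $ j * v $ i * v $ j)"
      using pq by (auto simp: quadratic_forms_def)
    then have "\<forall>v. (p + q) v = (\<Sum>i\<in>UNIV. \<Sum>j\<in>UNIV. (A + B) $ i $ j * v $ i * v $ j)"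
      by (simp add: sum.distrib distrib_right)
    then show ?thesis unfolding quadratic_forms_def by blast
  qed
  moreover have "form_scale c q \<in> quadratic_forms" if q: "q \<in> quadratic_forms" for c q
  proof -
    obtain A :: "complex ^ 3 ^ 3" where
      "\<And>v. q v = (\<Sum>i\<in>UNIV. \<Sum>j\<in>UNIV. A $ i $ j * v $ i * v $ j)"
      using q by (auto simp: quadratic_forms_def)
    then have "\<forall>v. form_scale c q v = (\<Sum>i\<in>UNIV. \<Sum>j\<in>UNIV. (\<chi> i j. c * A $ i $ j) $ i $ j * v $ i * v $ j)"
      by (simp add: form_scale_def sum_distrib_left mult.assoc)
    then show ?thesis unfolding quadratic_forms_def by blast
  qed
  ultimately show ?thesis by (simp add: forms.subspace_def)
qed

abbreviation plane_points :: "(complex ^ 3) set set" where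
  "plane_points \<equiv> plane.projective_points UNIV"

abbreviation plane_lines :: "(complex ^ 3) set set" where
  "plane_lines \<equiv> plane.projective_lines UNIV"

abbreviation conics :: "(complex ^ 3 \<Rightarrow> complex) set set" where
  "conics \<equiv> forms.projective_points quadratic_forms"

definition conic_points :: "(complex ^ 3 \<Rightarrow> complex) set \<Rightarrow> (complex ^ 3) set set" where
  "conic_points \<Gamma> = {X \<in> plane_points. \<forall>q\<in>\<Gamma>. \<forall>v\<in>X. q v = 0}"

abbreviation pencils :: "(complex ^ 3 \<Rightarrow> complex) set set" where
  "pencils \<equiv> forms.projective_lines quadratic_forms"

abbreviation pencil_conics ::
    "(complex ^ 3 \<Rightarrow> complex) set \<Rightarrow> (complex ^ 3 \<Rightarrow> complex) set set" where
  "pencil_conics \<F> \<equiv> forms.projective_points \<F>"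

definition nondegenerate_pencil :: "(complex ^ 3 \<Rightarrow> complex) set \<Rightarrow> bool" where
  "nondegenerate_pencil \<F> \<longleftrightarrow> \<F> \<in> pencils \<and>
     (\<exists>\<Gamma>\<in>conics. \<exists>\<Gamma>'\<in>conics. \<F> = forms.span (\<Gamma> \<union> \<Gamma>') \<and>
        card (conic_points \<Gamma> \<inter> conic_points \<Gamma>') = 4)"

text \<open>
  The common points of any two conics generating the pencil are common to all of its conics.
\<close>

definition base_points :: "(complex ^ 3 \<Rightarrow> complex) set \<Rightarrow> (complex ^ 3) set set" where
  "base_points \<F> = (\<Inter>\<Gamma>\<in>pencil_conics \<F>. conic_points \<Gamma>)"

lemma base_points_span:
  assumes "\<Gamma> \<in> conics" "\<Gamma>' \<in> conics"
  shows "base_points (forms.span (\<Gamma> \<union> \<Gamma>')) = conic_points \<Gamma> \<inter> conic_points \<Gamma>'"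
proof
  obtain q q' where q: "\<Gamma> = forms.span {q}" "q \<noteq> 0" "\<Gamma>' = forms.span {q'}" "q' \<noteq> 0"
    using assms by (auto simp: forms.projective_points_def)
  have "q \<in> \<Gamma> \<union> \<Gamma>'" "q' \<in> \<Gamma> \<union> \<Gamma>'" by (auto simp: q forms.span_base)
  then have "q \<in> forms.span (\<Gamma> \<union> \<Gamma>')" "q' \<in> forms.span (\<Gamma> \<union> \<Gamma>')" by (auto intro: forms.span_base)
  then have "\<Gamma> \<in> pencil_conics (forms.span (\<Gamma> \<union> \<Gamma>'))" "\<Gamma>' \<in> pencil_conics (forms.span (\<Gamma> \<union> \<Gamma>'))"
    using q by (auto simp: forms.projective_points_def)
  then show "base_points (forms.span (\<Gamma> \<union> \<Gamma>')) \<subseteq> conic_points \<Gamma> \<inter> conic_points \<Gamma>'"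
    unfolding base_points_def by blast
next
  show "conic_points \<Gamma> \<inter> conic_points \<Gamma>' \<subseteq> base_points (forms.span (\<Gamma> \<union> \<Gamma>'))"
  proof
    fix X assume X: "X \<in> conic_points \<Gamma> \<inter> conic_points \<Gamma>'"
    have "\<forall>v\<in>X. q v = 0" if "q \<in> forms.span (\<Gamma> \<union> \<Gamma>')" for q
      using that
    proof (induction rule: forms.span_induct_alt)
      case base
      then show ?case by simp
    next
      case (step c x y)
      then show ?case using X by (auto simp: conic_points_def form_scale_def)
    qed
    moreover have "\<Delta> \<subseteq> forms.span (\<Gamma> \<union> \<Gamma>')" if "\<Delta> \<in> pencil_conics (forms.span (\<Gamma> \<union> \<Gamma>'))" for \<Delta>
      using that forms.span_minimal[OF _ forms.subspace_span]
      by (auto simp: forms.projective_points_def forms.span_singleton intro: forms.span_scale)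
    ultimately show "X \<in> base_points (forms.span (\<Gamma> \<union> \<Gamma>'))"
      using X by (auto simp: base_points_def conic_points_def subset_iff)
  qed
qed

text \<open>
  A line not contained in a conic meets it in two points counted with multiplicity. So if \<open>P\<close> is
  one of them, the other one is the point \<open>M\<close> such that \<open>P\<close> and \<open>M\<close> are all the common points;
  \<open>M = P\<close> means that the line is tangent at \<open>P\<close> (or passes through a double point \<open>P\<close>).
\<close>

definition second_intersection ::
    "(complex ^ 3) set \<Rightarrow> (complex ^ 3) set \<Rightarrow> (complex ^ 3 \<Rightarrow> complex) set \<Rightarrow> (complex ^ 3) set"
where
  "second_intersection P d \<Gamma> =
     (THE M. plane.projective_points d \<inter> conic_points \<Gamma> = {P, M})"

lemma quadratic_form_combination:
  assumes "q \<in> quadratic_forms"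
  shows "\<exists>b. \<forall>x y. q (x *s v + y *s w) = x\<^sup>2 * q v + x * y * b + y\<^sup>2 * q w"
proof -
  obtain A :: "complex ^ 3 ^ 3" where
    A: "\<And>v. q v = (\<Sum>i\<in>UNIV. \<Sum>j\<in>UNIV. A $ i $ j * v $ i * v $ j)"
    using assms by (auto simp: quadratic_forms_def)
  let ?b = "\<Sum>i\<in>UNIV. \<Sum>j\<in>UNIV. A $ i $ j * (v $ i * w $ j + w $ i * v $ j)"
  have "q (x *s v + y *s w) = x\<^sup>2 * q v + x * y * ?b + y\<^sup>2 * q w" for x y
    unfolding A sum_distrib_left sum.distrib[symmetric]
    by (intro sum.cong refl) (simp add: power2_eq_square algebra_simps)
  then show ?thesis by blast
qed

lemma quadratic_form_scale:
  assumes "q \<in> quadratic_forms"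
  shows "q (x *s v) = x\<^sup>2 * q v"
  using assms by (auto simp: quadratic_forms_def sum_distrib_left power2_eq_square mult_ac)

lemma span_in_conic_points_iff:
  assumes "q \<in> quadratic_forms" "v \<noteq> 0"
  shows "vec.span {v} \<in> conic_points (forms.span {q}) \<longleftrightarrow> q v = 0"
proof
  assume "vec.span {v} \<in> conic_points (forms.span {q})"
  moreover have "q \<in> forms.span {q}" "v \<in> vec.span {v}"
    by (simp_all add: forms.span_base vec.span_base)
  ultimately show "q v = 0" unfolding conic_points_def by blast
next
  assume "q v = 0"
  then show "vec.span {v} \<in> conic_points (forms.span {q})"
    using assms by (auto simp: conic_points_def plane.projective_points_def forms.span_singleton
      vec.span_singleton form_scale_def quadratic_form_scale)
qed

lemma second_intersection_unique_existence:
  assumes "\<Gamma> \<in> conics" "d \<in> plane_lines" "P \<in> plane.projective_points d" "P \<in> conic_points \<Gamma>"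
    and "\<not> plane.projective_points d \<subseteq> conic_points \<Gamma>"
  shows "\<exists>!M. plane.projective_points d \<inter> conic_points \<Gamma> = {P, M}"
proof -
  obtain q where q: "\<Gamma> = forms.span {q}" "q \<in> quadratic_forms"
    using assms(1) by (auto simp: forms.projective_points_def)
  obtain p where p: "P = vec.span {p}" "p \<in> d" "p \<noteq> 0"
    using assms(3) by (auto simp: plane.projective_points_def)
  have d: "vec.subspace d" "vec.dim d = 2"
    using assms(2) by (auto simp: plane.projective_lines_def)
  have "vec.independent {p}" using p by (simp add: vec.dependent_single)
  then obtain B where B: "{p} \<subseteq> B" "B \<subseteq> d" "vec.independent B" "d \<subseteq> vec.span B"
    using vec.maximal_independent_subset_extend[of "{p}" d] p by auto
  have "card B = 2" using vec.basis_card_eq_dim[OF B(2,4,3)] d by simp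
  then obtain u where u: "B = {p, u}" "p \<noteq> u" using B(1) by (auto simp: card_2_iff)
  have dsp: "d = vec.span {p, u}"
    using B u d vec.span_minimal by blast
  have ind: "vec.independent {p, u}" using B u by simp
  have inz: "x *s p + y *s u \<noteq> 0" if "x \<noteq> 0 \<or> y \<noteq> 0" for x y
    using plane.independent_pair[OF u(2) ind, of x y] that by blast
  have din: "x *s p + y *s u \<in> d" for x y
    unfolding dsp by (intro vec.span_add vec.span_scale vec.span_base) auto
  have dE: "\<exists>x y. v = x *s p + y *s u" if "v \<in> d" for v
  proof -
    obtain k where "v - k *s p \<in> vec.span {u}" using \<open>v \<in> d\<close> unfolding dsp by (auto simp: vec.span_breakdown_eq)
    then obtain l where "v - k *s p = l *s u" by (auto simp: vec.span_singleton)
    then have "v = k *s p + l *s u" by (simp add: algebra_simps)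
    then show ?thesis by blast
  qed
  have "q p = 0" using assms(4) span_in_conic_points_iff[OF q(2) p(3)] by (simp add: p q)
  then obtain b where b: "\<And>x y. q (x *s p + y *s u) = y * (x * b + y * q u)"
    using quadratic_form_combination[OF q(2), of p u] by (auto simp: power2_eq_square algebra_simps)
  have bc: "b \<noteq> 0 \<or> q u \<noteq> 0"
  proof (rule ccontr)
    assume "\<not> (b \<noteq> 0 \<or> q u \<noteq> 0)"
    then have "q v = 0" if "v \<in> d" for v using dE[OF that] b by auto
    then have "plane.projective_points d \<subseteq> conic_points \<Gamma>"
      using span_in_conic_points_iff[OF q(2)] by (auto simp: plane.projective_points_def q)
    with assms(5) show False by simp
  qed
  define m where "m = q u *s p + (- b) *s u"
  define M where "M = vec.span {m}"
  have m: "m \<noteq> 0" "m \<in> d" "q m = 0"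
    using inz[of "q u" "- b"] bc din[of "q u" "- b"] b[of "q u" "- b"] by (auto simp: m_def)
  have sp: "vec.span {k *s v} = vec.span {v}" if "k \<noteq> 0" for k and v :: "complex ^ 3"
    using that vec.span_image_scale[of "{v}" "\<lambda>_. k"] by simp
  have M: "plane.projective_points d \<inter> conic_points \<Gamma> = {P, M}"
  proof
    show "{P, M} \<subseteq> plane.projective_points d \<inter> conic_points \<Gamma>"
      using assms(3,4) m span_in_conic_points_iff[OF q(2) m(1)]
      by (auto simp: M_def q plane.projective_points_def)
  next
    show "plane.projective_points d \<inter> conic_points \<Gamma> \<subseteq> {P, M}"
    proof
      fix X assume X: "X \<in> plane.projective_points d \<inter> conic_points \<Gamma>"
      then obtain v where v: "X = vec.span {v}" "v \<in> d" "v \<noteq> 0"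
        by (auto simp: plane.projective_points_def)
      obtain x y where xy: "v = x *s p + y *s u" using dE[OF v(2)] by blast
      have "q v = 0" using X span_in_conic_points_iff[OF q(2) v(3)] by (simp add: v q)
      then have "y = 0 \<or> x * b + y * q u = 0" by (simp add: xy b)
      then show "X \<in> {P, M}"
      proof
        assume "y = 0"
        then have "v = x *s p" "x \<noteq> 0" using xy v by auto
        then show ?thesis using sp by (simp add: v p)
      next
        assume *: "x * b + y * q u = 0"
        show ?thesis
        proof (cases "b = 0")
          case True
          then have "y = 0" using * bc by simp
          then have "v = x *s p" "x \<noteq> 0" using xy v by auto
          then show ?thesis using sp by (simp add: v p)
        next
          case False
          have "x = (- y / b) * q u" using * False by (simp add: field_simps eq_neg_iff_add_eq_0)
          moreover have "y = (- y / b) * (- b)" using False by simp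
          ultimately have vm: "v = (- y / b) *s m"
            unfolding xy m_def by (metis vec.scale_right_distrib vec.scale_scale)
          then have "- y / b \<noteq> 0" using v(3) by auto
          then show ?thesis using sp[of "- y / b" m] vm by (simp add: v M_def)
        qed
      qed
    qed
  qed
  show ?thesis
  proof (rule ex1I[of _ M])
    fix M' assume "plane.projective_points d \<inter> conic_points \<Gamma> = {P, M'}"
    then show "M' = M" using M by (metis doubleton_eq_iff)
  qed (rule M)
qed

end

theory Submission
  imports Defs
begin

text \<open>
  On a line \<open>d\<close> through a base point \<open>p\<close>, spanned by \<open>p\<close> and \<open>u\<close>, every form \<open>g\<close> of the pencil has
  the shape \<open>g (x p + y u) = y (x b + y c)\<close>, so that the second intersection is \<open>c p - b u\<close>. Since
  \<open>b\<close> and \<open>c\<close> depend linearly on \<open>g\<close>, this is a projective map from the pencil to \<open>d\<close>, which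
  preserves cross ratios if it is injective, i.e. if no conic of the pencil contains \<open>d\<close>. A conic
  containing \<open>d\<close> would be the union of \<open>d\<close> and another line; the latter would contain the three base
  points off \<open>d\<close>, hence lie in all conics of the pencil, which have only four common points.
\<close>

section \<open>Bases of two-dimensional subspaces and projective maps between lines\<close>

lemma (in projective_space) dim_2_basis:
  assumes "subspace V" "dim V = 2" "p \<in> V" "p \<noteq> 0"
  obtains u where "p \<noteq> u" "independent {p, u}" "V = span {p, u}"
proof -
  have "independent {p}" using assms by (simp add: dependent_single)
  then obtain B where B: "{p} \<subseteq> B" "B \<subseteq> V" "independent B" "V \<subseteq> span B"
    using maximal_independent_subset_extend[of "{p}" V] assms by auto
  have "card B = 2" using basis_card_eq_dim[OF B(2,4,3)] assms by simp
  then obtain u where u: "B = {p, u}" "p \<noteq> u" using B(1) by (auto simp: card_2_iff)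
  then show ?thesis using that[of u] B span_minimal[OF B(2) assms(1)] by auto
qed

lemma (in projective_space) span_pairE:
  assumes "v \<in> span {p, u}"
  obtains x y where "v = scale x p + scale y u"
proof -
  obtain k where "v - scale k p \<in> span {u}" using assms by (auto simp: span_breakdown_eq)
  then obtain l where "v - scale k p = scale l u" by (auto simp: span_singleton)
  then have "v = scale k p + scale l u" by (simp add: algebra_simps)
  then show ?thesis by (rule that)
qed

lemma (in projective_space) span_pairI: "scale x p + scale y u \<in> span {p, u}"
  by (intro span_add span_scale span_base) auto

lemma (in projective_space) span_scale_eq: "k \<noteq> 0 \<Longrightarrow> span {scale k v} = span {v}"
  using span_image_scale[of "{v}" "\<lambda>_. k"] by simp

text \<open>A \<open>bracket\<close> is a determinant of coordinate vectors, so a linear change of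
  coordinates multiplies it by the determinant of the matrix. Numerator and denominator of the cross
  ratio each contain two brackets, and the squared determinant cancels. The target has its own
  \<open>scale'\<close> because the pencil and the line \<open>d\<close> lie in different vector
  spaces over the same field.\<close>

lemma (in projective_space) cross_ratio_linear:
  assumes "projective_space scale'"
    and "e \<noteq> f" "independent {e, f}"
    and "e' \<noteq> f'" "\<not> module.dependent scale' {e', f'}"
    and det: "\<alpha> * \<delta> - \<beta> * \<gamma> \<noteq> 0"
    and "A = span {scale (fst a) e + scale (snd a) f}" "a \<noteq> (0, 0)"
    and "B = span {scale (fst b) e + scale (snd b) f}" "b \<noteq> (0, 0)"
    and "C = span {scale (fst c) e + scale (snd c) f}" "c \<noteq> (0, 0)"
    and "D = span {scale (fst d) e + scale (snd d) f}" "d \<noteq> (0, 0)"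
  defines "\<phi> \<equiv> \<lambda>x. module.span scale' {scale' (\<alpha> * fst x + \<beta> * snd x) e'
    + scale' (\<gamma> * fst x + \<delta> * snd x) f'}"
  shows "cross_ratio A B C D =
    projective_space.cross_ratio scale' (\<phi> a) (\<phi> b) (\<phi> c) (\<phi> d)"
proof -
  interpret V': projective_space scale' by fact
  define h where "h x = (\<alpha> * fst x + \<beta> * snd x, \<gamma> * fst x + \<delta> * snd x)" for x
  have "h x \<noteq> (0, 0)" if "x \<noteq> (0, 0)" for x
  proof
    assume "h x = (0, 0)"
    then have *: "\<alpha> * fst x + \<beta> * snd x = 0" "\<gamma> * fst x + \<delta> * snd x = 0" by (auto simp: h_def)
    have "(\<alpha> * \<delta> - \<beta> * \<gamma>) * fst x
        = \<delta> * (\<alpha> * fst x + \<beta> * snd x) - \<beta> * (\<gamma> * fst x + \<delta> * snd x)"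
      "(\<alpha> * \<delta> - \<beta> * \<gamma>) * snd x
        = \<alpha> * (\<gamma> * fst x + \<delta> * snd x) - \<gamma> * (\<alpha> * fst x + \<beta> * snd x)"
      by (simp_all add: algebra_simps)
    then have "fst x = 0" "snd x = 0" using det unfolding * by auto
    with that show False by (simp add: prod_eq_iff)
  qed
  then have h: "V'.homogeneous_coordinates e' f' (\<phi> x) (h x)" if "x \<noteq> (0, 0)" for x
    using that by (simp add: V'.homogeneous_coordinates_def \<phi>_def h_def)
  have br: "bracket (h x) (h y) = (\<alpha> * \<delta> - \<beta> * \<gamma>) * bracket x y" for x y
    by (simp add: bracket_def h_def algebra_simps)
  let ?k = "(\<alpha> * \<delta> - \<beta> * \<gamma>)\<^sup>2"
  have "V'.cross_ratio (\<phi> a) (\<phi> b) (\<phi> c) (\<phi> d) =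
      extended_quotient (bracket (h a) (h c) * bracket (h b) (h d))
        (bracket (h b) (h c) * bracket (h a) (h d))"
    by (rule V'.cross_ratio_eq[OF assms(4,5)]) (intro h assms)+
  also have "\<dots> = extended_quotient (?k * (bracket a c * bracket b d))
        (?k * (bracket b c * bracket a d))"
    by (simp add: br power2_eq_square mult_ac)
  also have "\<dots> = extended_quotient (bracket a c * bracket b d) (bracket b c * bracket a d)"
    using det by (simp add: extended_quotient_mult)
  also have "\<dots> = cross_ratio A B C D"
    by (rule cross_ratio_eq[symmetric]) (use assms in \<open>simp_all add: homogeneous_coordinates_def\<close>)
  finally show ?thesis by simp
qed

section \<open>Quadratic forms and base points of a pencil\<close>

text \<open>With \<open>w\<close> fixed, \<open>f\<close> is the polar form of \<open>q\<close> at
  \<open>w\<close>. In contrast to \<open>quadratic_form_combination\<close>, the cross term is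
  available here as a linear function of \<open>v\<close>.\<close>

lemma quadratic_form_polar:
  assumes "q \<in> quadratic_forms"
  obtains f where "\<And>u v. f (u + v) = f u + f v" "\<And>k v. f (k *s v) = k * f v"
    "\<And>v y. q (v + y *s w) = q v + y * f v + y\<^sup>2 * q w"
proof -
  obtain A :: "complex ^ 3 ^ 3" where
    A: "\<And>v. q v = (\<Sum>i\<in>UNIV. \<Sum>j\<in>UNIV. A $ i $ j * v $ i * v $ j)"
    using assms by (auto simp: quadratic_forms_def)
  define f where "f v = (\<Sum>i\<in>UNIV. \<Sum>j\<in>UNIV. A $ i $ j * (v $ i * w $ j + w $ i * v $ j))" for v
  show ?thesis
  proof (rule that[of f])
    show "f (u + v) = f u + f v" for u v
      unfolding f_def sum.distrib[symmetric] by (intro sum.cong refl) (simp add: algebra_simps)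
    show "f (k *s v) = k * f v" for k v
      unfolding f_def sum_distrib_left by (intro sum.cong refl) (simp add: algebra_simps)
    show "q (v + y *s w) = q v + y * f v + y\<^sup>2 * q w" for v y
      unfolding A f_def sum_distrib_left sum.distrib[symmetric]
      by (intro sum.cong refl) (simp add: power2_eq_square algebra_simps)
  qed
qed

lemma base_points_iff:
  assumes "\<F> \<in> pencils" "v \<noteq> 0"
  shows "vec.span {v} \<in> base_points \<F> \<longleftrightarrow> (\<forall>q\<in>\<F>. q v = 0)"
proof -
  have F: "\<F> \<subseteq> quadratic_forms" using assms by (auto simp: forms.projective_lines_def)
  have "vec.span {v} \<in> base_points \<F> \<longleftrightarrow>
      (\<forall>q\<in>\<F>. q \<noteq> 0 \<longrightarrow> vec.span {v} \<in> conic_points (forms.span {q}))"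
    by (auto simp: base_points_def forms.projective_points_def)
  also have "\<dots> \<longleftrightarrow> (\<forall>q\<in>\<F>. q \<noteq> 0 \<longrightarrow> q v = 0)"
    using span_in_conic_points_iff[OF _ assms(2)] F by blast
  finally show ?thesis by auto
qed

text \<open>Dimension 2 provides a nonzero form, hence a conic in the pencil; over an empty family
  the intersection defining \<open>base_points\<close> would be everything.\<close>

lemma base_points_subset:
  assumes "\<F> \<in> pencils"
  shows "base_points \<F> \<subseteq> plane_points"
proof -
  have F: "forms.subspace \<F>" "forms.dim \<F> = 2"
    using assms by (auto simp: forms.projective_lines_def)
  have "\<exists>q\<in>\<F>. q \<noteq> 0"
  proof (rule ccontr)
    assume "\<not> ?thesis"
    then have "\<F> \<subseteq> forms.span {}" by auto
    from forms.dim_le_card[OF this] F show False by simp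
  qed
  then show ?thesis by (auto simp: base_points_def forms.projective_points_def conic_points_def)
qed

lemma card_base_points:
  assumes "nondegenerate_pencil \<F>"
  shows "card (base_points \<F>) = 4"
  using assms by (auto simp: nondegenerate_pencil_def base_points_span)

text \<open>In the coordinates given by \<open>v\<close> and \<open>w\<close>, \<open>q\<close> is a
  binary quadratic form. It has the three pairwise non-proportional zeros (0, 1), (s, y) and (t, z),
  one more than its degree allows unless it is zero.\<close>

lemma quadratic_form_three_zeros:
  assumes "q \<in> quadratic_forms" "q w = 0"
    and "q (s *s v + y *s w) = 0" "q (t *s v + z *s w) = 0"
    and "s \<noteq> 0" "t \<noteq> 0" "s * z \<noteq> t * y"
  shows "q (k *s v + l *s w) = 0"
proof -
  obtain b where b: "\<And>x y. q (x *s v + y *s w) = x\<^sup>2 * q v + x * y * b + y\<^sup>2 * q w"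
    using quadratic_form_combination[OF assms(1), of v w] by blast
  \<comment> \<open>The zero at \<open>w\<close> removes the last term; the other two zeros give a
    homogeneous linear system for \<open>q v\<close> and \<open>b\<close> with determinant
    \<open>s * z - t * y\<close>.\<close>
  have "s * (s * q v + y * b) = 0" "t * (t * q v + z * b) = 0"
    using assms(3,4) by (simp_all add: b assms(2) power2_eq_square algebra_simps)
  then have e: "s * q v + y * b = 0" "t * q v + z * b = 0" using assms(5,6) by auto
  have "(s * z - t * y) * b = s * (t * q v + z * b) - t * (s * q v + y * b)"
    by (simp add: algebra_simps)
  then have "b = 0" using assms(7) by (simp add: e)
  then have "q v = 0" using e(1) assms(5) by simp
  then show ?thesis by (simp add: b \<open>b = 0\<close> assms(2))
qed

section \<open>Conics of the pencil containing a line\<close>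

text \<open>The parameter \<open>t\<close> is an affine coordinate on the line with the point of
  \<open>f\<close> removed. A line can therefore not consist of base points only.\<close>

lemma infinite_points_on_line:
  assumes "e \<noteq> f" "vec.independent {e, f :: complex ^ 3}"
  shows "infinite (range (\<lambda>t. vec.span {e + t *s f}))"
proof -
  have "inj (\<lambda>t. vec.span {e + t *s f})"
  proof (rule injI)
    fix s t assume "vec.span {e + s *s f} = vec.span {e + t *s f}"
    then have "e + s *s f \<in> vec.span {e + t *s f}" by (metis vec.span_base singletonI)
    then obtain k where "e + s *s f = k *s (e + t *s f)" by (auto simp: vec.span_singleton)
    then have "1 *s e + s *s f = k *s e + (k * t) *s f"
      by (simp add: vec.scale_right_distrib)
    from plane.independent_pair_eq[OF assms this] show "s = t" by simp
  qed
  then show ?thesis using finite_imageD infinite_UNIV_char_0 by blast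
qed

text \<open>A form vanishing on \<open>d\<close> is the product of an equation of \<open>d\<close>
  and a linear form. By \<open>single\<close>, three base points lie off \<open>d\<close>, hence on
  the zero line of the second factor, where \<open>quadratic_form_three_zeros\<close> applies to
  every form of the pencil.\<close>

lemma pencil_line_not_in_conic:
  assumes "nondegenerate_pencil \<F>" "d \<in> plane_lines"
    and single: "plane.projective_points d \<inter> base_points \<F> = {P}"
    and q: "q \<in> \<F>" "q \<noteq> 0"
  shows "\<exists>v\<in>d. q v \<noteq> 0"
proof (rule ccontr)
  assume "\<not> ?thesis"
  then have qd: "\<And>v. v \<in> d \<Longrightarrow> q v = 0" by blast
  have pencil: "\<F> \<in> pencils" using assms(1) by (simp add: nondegenerate_pencil_def)
  then have F: "\<F> \<subseteq> quadratic_forms" by (auto simp: forms.projective_lines_def)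
  have d: "vec.subspace d" "vec.dim d = 2"
    using assms(2) by (auto simp: plane.projective_lines_def)
  have "P \<in> plane.projective_points d" using single by blast
  then obtain p where p: "P = vec.span {p}" "p \<in> d" "p \<noteq> 0"
    by (auto simp: plane.projective_points_def)
  obtain u where u: "p \<noteq> u" "vec.independent {p, u}" "d = vec.span {p, u}"
    using plane.dim_2_basis[OF d p(2,3)] .

  have fin: "finite (base_points \<F>)" "card (base_points \<F> - {P}) = 3"
    using card_base_points[OF assms(1)] single
    by (auto simp: card_ge_0_finite card_Diff_singleton_if set_eq_iff)
  then obtain X1 X2 X3 where X: "base_points \<F> - {P} = {X1, X2, X3}"
      "X1 \<noteq> X2" "X2 \<noteq> X3" "X1 \<noteq> X3"
    by (auto simp: card_3_iff)
  have off: "\<exists>v. X = vec.span {v} \<and> v \<notin> d \<and> (\<forall>r\<in>\<F>. r v = 0)" if "X \<in> {X1, X2, X3}" for X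
  proof -
    have "X \<in> base_points \<F>" "X \<noteq> P" using that X by auto
    moreover then obtain v where v: "X = vec.span {v}" "v \<noteq> 0"
      using base_points_subset[OF pencil] by (auto simp: plane.projective_points_def)
    ultimately have "v \<notin> d" using single by (auto simp: plane.projective_points_def)
    then show ?thesis using v \<open>X \<in> base_points \<F>\<close> base_points_iff[OF pencil v(2)] by auto
  qed
  obtain w where w: "X1 = vec.span {w}" "w \<notin> d" "\<forall>r\<in>\<F>. r w = 0" using off[of X1] by auto
  obtain x2 where x2: "X2 = vec.span {x2}" "x2 \<notin> d" "\<forall>r\<in>\<F>. r x2 = 0" using off[of X2] by auto
  obtain x3 where x3: "X3 = vec.span {x3}" "x3 \<notin> d" "\<forall>r\<in>\<F>. r x3 = 0" using off[of X3] by auto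

  \<comment> \<open>The base point \<open>w\<close> off \<open>d\<close> completes the basis of
    \<open>d\<close> to one of the whole space.\<close>
  have "vec.independent {w, p, u}"
    using w(2) u by (simp add: vec.independent_insert)
  moreover have "card {w, p, u} = 3"
  proof -
    have "w \<noteq> p" "w \<noteq> u" using w(2) p(2) vec.span_base[of u "{p, u}"] by (auto simp: u(3))
    then show ?thesis using u(1) by simp
  qed
  ultimately have "vec.span {w, p, u} = UNIV"
    using vec.card_ge_dim_independent[of "{w, p, u}" UNIV] by (simp add: vec.dim_UNIV card_cart_basis top.extremum_unique)
  then have split: "\<exists>z v. v \<in> d \<and> x = v + z *s w" for x
  proof -
    have "x \<in> vec.span {w, p, u}" using \<open>_ = UNIV\<close> by simp
    then obtain z where "x - z *s w \<in> d" by (auto simp: vec.span_breakdown_eq[of _ w] u(3))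
    then show ?thesis by (metis diff_add_cancel)
  qed

  obtain f where f: "\<And>u v. f (u + v) = f u + f v" "\<And>k v. f (k *s v) = k * f v"
    "\<And>v y. q (v + y *s w) = q v + y * f v + y\<^sup>2 * q w"
    using quadratic_form_polar[of q w] q F by blast
  \<comment> \<open>Since \<open>q\<close> vanishes on \<open>d\<close> and at \<open>w\<close>,
    only the cross term survives. This is the factorization: \<open>z\<close> is an equation of
    \<open>d\<close>, and \<open>f v\<close> is the other linear factor.\<close>
  have qf: "q (v + z *s w) = z * f v" if "v \<in> d" for v z
    using f(3)[of v z] qd[OF that] w(3) q(1) by simp
  have nz: "f p \<noteq> 0 \<or> f u \<noteq> 0"
  proof (rule ccontr)
    assume *: "\<not> ?thesis"
    have "q x = 0" for x
    proof -
      obtain z v where v: "v \<in> d" "x = v + z *s w" using split by blast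
      obtain a b where "v = a *s p + b *s u" using v(1) unfolding u(3) by (rule plane.span_pairE)
      then have "f v = 0" using * by (simp add: f)
      then show ?thesis using qf[OF v(1)] v(2) by simp
    qed
    then show False using q(2) by (simp add: fun_eq_iff)
  qed
  \<comment> \<open>The point where the second line meets \<open>d\<close>: the zero of
    \<open>f\<close> on \<open>d\<close>, unique up to scaling by \<open>nz\<close>.\<close>
  define e where "e = f u *s p + (- f p) *s u"
  have e: "e \<in> d" "e \<noteq> 0"
    using plane.span_pairI[of "f u" p "- f p" u] plane.independent_pair[OF u(1,2), of "f u" "- f p"] nz
    by (auto simp: e_def u(3))
  have fe: "f e = 0" unfolding e_def f by simp
  \<comment> \<open>The conic is the union of \<open>d\<close> and the line spanned by \<open>e\<close> and \<open>w\<close>.\<close>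
  have line: "\<exists>t z. x = t *s e + z *s w" if "q x = 0" "x \<notin> d" for x
  proof -
    obtain z v where v: "v \<in> d" "x = v + z *s w" using split by blast
    have "z \<noteq> 0" using that(2) v by auto
    then have "f v = 0" using that(1) qf[OF v(1)] v(2) by simp
    obtain a b where ab: "v = a *s p + b *s u" using v(1) unfolding u(3) by (rule plane.span_pairE)
    then have 0: "a * f p + b * f u = 0" using \<open>f v = 0\<close> by (simp add: f)
    have "\<exists>t. a = t * f u \<and> b = t * (- f p)"
    proof (cases "f u = 0")
      case True
      then show ?thesis using 0 nz by (intro exI[of _ "- b / f p"]) auto
    next
      case False
      then show ?thesis using 0
        by (intro exI[of _ "a / f u"]) (auto simp: field_simps eq_neg_iff_add_eq_0)
    qed
    then obtain t where "v = t *s e"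
      unfolding ab e_def by (metis vec.scale_right_distrib vec.scale_scale)
    then show ?thesis using v(2) by blast
  qed
  have ew: "e \<noteq> w" "vec.independent {e, w}"
  proof -
    show "e \<noteq> w" using e w by auto
    have "w \<notin> vec.span {e}"
      using e w d vec.span_minimal[of "{e}" d] by auto
    then show "vec.independent {e, w}"
      using e \<open>e \<noteq> w\<close> by (simp add: insert_commute[of e w] vec.independent_insert vec.dependent_single)
  qed
  have "q x2 = 0" "q x3 = 0" using x2 x3 q by auto
  then obtain t2 z2 t3 z3 where x2': "x2 = t2 *s e + z2 *s w" and x3': "x3 = t3 *s e + z3 *s w"
    using line x2(2) x3(2) by metis
  have z: "z2 \<noteq> 0" "z3 \<noteq> 0" using x2(2) x3(2) e(1) d(1) by (auto simp: x2' x3' vec.subspace_scale)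
  \<comment> \<open>Distinctness of the base points becomes the non-proportionality of zeros:
    \<open>t\<close> says that \<open>X2\<close> and \<open>X3\<close> differ from
    \<open>X1\<close>, and \<open>tz\<close> that they differ from each other.\<close>
  have t: "t2 \<noteq> 0" "t3 \<noteq> 0"
    using X(2,4) z plane.span_scale_eq by (auto simp: w(1) x2(1) x3(1) x2' x3')
  have tz: "t2 * z3 \<noteq> t3 * z2"
  proof
    assume "t2 * z3 = t3 * z2"
    then have "x3 = (t3 / t2) *s x2" "t3 / t2 \<noteq> 0"
      using t by (simp_all add: x2' x3' vec.scale_right_distrib field_simps)
    then show False using X(3) plane.span_scale_eq by (metis x2(1) x3(1))
  qed
  have "r (k *s e + l *s w) = 0" if "r \<in> \<F>" for r k l
    using quadratic_form_three_zeros[OF _ _ _ _ t tz, of r w e k l] that F w(3) x2(3) x3(3) x2' x3'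
    by auto
  then have "\<forall>r\<in>\<F>. r (e + k *s w) = 0" for k
    using vec.scale_one by metis
  moreover have "e + k *s w \<noteq> 0" for k
    using plane.independent_pair[OF ew, of 1 k] by auto
  ultimately have "range (\<lambda>t. vec.span {e + t *s w}) \<subseteq> base_points \<F>"
    using base_points_iff[OF pencil] by blast
  then show False using infinite_points_on_line[OF ew] fin(1) finite_subset by blast
qed

section \<open>The second intersection in coordinates and the cross ratio\<close>

text \<open>The factor \<open>y\<close> vanishes at the point of \<open>p\<close>, and the factor x
  b + y c at the point with coordinates (c, -b). By \<open>bc\<close> the form is not zero on
  \<open>d\<close>, so that \<open>second_intersection_unique_existence\<close> justifies the
  definite description.\<close>

lemma second_intersection_eq:
  assumes "g \<in> quadratic_forms"
    and pu: "p \<noteq> u" "vec.independent {p, u}" "d = vec.span {p, u}"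
    and "d \<in> plane_lines"
    and g: "\<And>x y. g (x *s p + y *s u) = y * (x * b + y * c)"
    and bc: "b \<noteq> 0 \<or> c \<noteq> 0"
  shows "second_intersection (vec.span {p}) d (forms.span {g}) = vec.span {c *s p + (- b) *s u}"
proof -
  let ?P = "vec.span {p}" and ?\<Gamma> = "forms.span {g}" and ?m = "c *s p + (- b) *s u"
  note ind = plane.independent_pair[OF pu(1,2)]
  have nonzero: "x *s p + y *s u \<noteq> 0" if "x \<noteq> 0 \<or> y \<noteq> 0" for x y
    using ind that by blast
  have point: "vec.span {x *s p + y *s u} \<in> plane.projective_points d \<inter> conic_points ?\<Gamma> \<longleftrightarrow>
      y * (x * b + y * c) = 0" if "x \<noteq> 0 \<or> y \<noteq> 0" for x y
    using span_in_conic_points_iff[OF assms(1) nonzero[OF that]] nonzero[OF that]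
      plane.span_pairI[of x p y u] g by (auto simp: plane.projective_points_def pu(3))
  have p: "?P \<in> plane.projective_points d \<inter> conic_points ?\<Gamma>" using point[of 1 0] by simp
  have m: "vec.span {?m} \<in> plane.projective_points d \<inter> conic_points ?\<Gamma>"
    using point[of c "- b"] bc by auto
  obtain x y where xy: "x \<noteq> 0 \<or> y \<noteq> 0" "g (x *s p + y *s u) \<noteq> 0"
  proof (cases "b = 0")
    case True
    then show ?thesis using that[of 0 1] g[of 0 1] bc by auto
  next
    case False
    \<comment> \<open>The first coordinate is chosen so that the value of \<open>g\<close> is
      \<open>b\<close>.\<close>
    have "g ((1 - c / b) *s p + 1 *s u) \<noteq> 0" using False unfolding g by (simp add: field_simps)
    then show ?thesis using that[of "1 - c / b" 1] by simp
  qed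
  have "vec.span {x *s p + y *s u} \<in> plane.projective_points d"
    using nonzero[OF xy(1)] plane.span_pairI[of x p y u]
    by (auto simp: plane.projective_points_def pu(3))
  moreover have "vec.span {x *s p + y *s u} \<notin> plane.projective_points d \<inter> conic_points ?\<Gamma>"
    using xy(2) unfolding point[OF xy(1)] g .
  ultimately have proper: "\<not> plane.projective_points d \<subseteq> conic_points ?\<Gamma>" by blast
  have "g \<noteq> 0" using xy(2) by auto
  then have "?\<Gamma> \<in> conics" using assms(1) by (auto simp: forms.projective_points_def)
  note ex1 = second_intersection_unique_existence[OF this assms(5) IntD1[OF p] IntD2[OF p] proper]
  obtain M where M: "plane.projective_points d \<inter> conic_points ?\<Gamma> = {?P, M}"
    using ex1_implies_ex[OF ex1] by (rule exE)
  \<comment> \<open>Membership of \<open>?m\<close> in the intersection settles this unless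
    \<open>?m\<close> gives \<open>?P\<close>. In that case \<open>b = 0\<close>, the restriction of
    \<open>g\<close> to \<open>d\<close> is y squared times \<open>c\<close>, and \<open>?P\<close>
    is the only common point.\<close>
  have "M = vec.span {?m}"
  proof (rule ccontr)
    assume neq: "M \<noteq> vec.span {?m}"
    then have mP: "vec.span {?m} = ?P" and MP: "M \<noteq> ?P" using m M by auto
    have "?m \<in> ?P" using mP vec.span_base by blast
    then obtain k where "c *s p + (- b) *s u = k *s p + 0 *s u" by (auto simp: vec.span_singleton)
    from plane.independent_pair_eq[OF pu(1,2) this] have "b = 0" by simp
    have "M \<in> plane.projective_points d" using M by blast
    then obtain v where v: "M = vec.span {v}" "v \<in> d" "v \<noteq> 0"
      by (auto simp: plane.projective_points_def)
    obtain x y where v': "v = x *s p + y *s u" using v(2) unfolding pu(3) by (rule plane.span_pairE)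
    then have "x \<noteq> 0 \<or> y \<noteq> 0" using v(3) by auto
    then have "y * (x * b + y * c) = 0" using point M v v' by auto
    then have "y = 0" using \<open>b = 0\<close> bc by simp
    then have "v = x *s p" "x \<noteq> 0" using v' v(3) by auto
    then show False using MP v(1) plane.span_scale_eq by auto
  qed
  then show ?thesis unfolding second_intersection_def using the1_equality[OF ex1 M] by simp
qed

text \<open>Passing through one base point is read as passing through exactly one: a line through
  two of them is part of a degenerate conic of the pencil, and its second intersection with that
  conic is not determined.\<close>

theorem theorem3:
  fixes \<F> :: "(complex ^ 3 \<Rightarrow> complex) set"
    and \<Gamma>\<^sub>1 \<Gamma>\<^sub>2 \<Gamma>\<^sub>3 \<Gamma>\<^sub>4 :: "(complex ^ 3 \<Rightarrow> complex) set"
    and d P M\<^sub>1 M\<^sub>2 M\<^sub>3 M\<^sub>4 :: "(complex ^ 3) set"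
  assumes "nondegenerate_pencil \<F>"
    and "\<Gamma>\<^sub>1 \<in> pencil_conics \<F>" "\<Gamma>\<^sub>2 \<in> pencil_conics \<F>"
        "\<Gamma>\<^sub>3 \<in> pencil_conics \<F>" "\<Gamma>\<^sub>4 \<in> pencil_conics \<F>"
    and "d \<in> plane_lines"
    and "plane.projective_points d \<inter> base_points \<F> = {P}"
    and "M\<^sub>1 = second_intersection P d \<Gamma>\<^sub>1" "M\<^sub>2 = second_intersection P d \<Gamma>\<^sub>2"
        "M\<^sub>3 = second_intersection P d \<Gamma>\<^sub>3" "M\<^sub>4 = second_intersection P d \<Gamma>\<^sub>4"
  shows "forms.cross_ratio \<Gamma>\<^sub>1 \<Gamma>\<^sub>2 \<Gamma>\<^sub>3 \<Gamma>\<^sub>4 = plane.cross_ratio M\<^sub>1 M\<^sub>2 M\<^sub>3 M\<^sub>4"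
proof -
  have pencil: "\<F> \<in> pencils" using assms(1) by (simp add: nondegenerate_pencil_def)
  then have F: "\<F> \<subseteq> quadratic_forms" "forms.subspace \<F>" "forms.dim \<F> = 2"
    by (auto simp: forms.projective_lines_def)
  have d: "vec.subspace d" "vec.dim d = 2"
    using assms(6) by (auto simp: plane.projective_lines_def)
  have "P \<in> plane.projective_points d" using assms(7) by blast
  then obtain p where p: "P = vec.span {p}" "p \<in> d" "p \<noteq> 0"
    by (auto simp: plane.projective_points_def)
  obtain u where u: "p \<noteq> u" "vec.independent {p, u}" "d = vec.span {p, u}"
    using plane.dim_2_basis[OF d p(2,3)] .
  have Fp: "\<And>q. q \<in> \<F> \<Longrightarrow> q p = 0"
    using base_points_iff[OF pencil p(3)] assms(7) p(1) by auto
  obtain q1 where q1: "q1 \<in> \<F>" "q1 \<noteq> 0"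
    using assms(2) by (auto simp: forms.projective_points_def)
  obtain q2 where q: "q1 \<noteq> q2" "forms.independent {q1, q2}" "\<F> = forms.span {q1, q2}"
    using forms.dim_2_basis[OF F(2,3) q1] .
  have q2: "q2 \<in> \<F>" by (simp add: q(3) forms.span_base)
  obtain b1 where b1: "\<And>x y. q1 (x *s p + y *s u) = x\<^sup>2 * q1 p + x * y * b1 + y\<^sup>2 * q1 u"
    using quadratic_form_combination[of q1 p u] F(1) q1(1) by blast
  obtain b2 where b2: "\<And>x y. q2 (x *s p + y *s u) = x\<^sup>2 * q2 p + x * y * b2 + y\<^sup>2 * q2 u"
    using quadratic_form_combination[of q2 p u] F(1) q2 by blast

  \<comment> \<open>Here \<open>x\<close> is a pair of homogeneous coordinates on the pencil. Since
    all its forms vanish at \<open>p\<close>, the restriction of \<open>?g x\<close> to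
    \<open>d\<close> has the shape required by \<open>second_intersection_eq\<close>, with
    coefficients \<open>?b x\<close> and \<open>?c x\<close> linear in \<open>x\<close>.\<close>
  let ?g = "\<lambda>x. form_scale (fst x) q1 + form_scale (snd x) q2"
  let ?b = "\<lambda>x. fst x * b1 + snd x * b2" and ?c = "\<lambda>x. fst x * q1 u + snd x * q2 u"
  have g: "?g a (x *s p + y *s u) = y * (x * ?b a + y * ?c a)" for a x y
    using Fp[OF q1(1)] Fp[OF q2] b1[of x y] b2[of x y]
    by (simp add: form_scale_def power2_eq_square algebra_simps)
  have gF: "?g a \<in> \<F>" for a unfolding q(3) by (rule forms.span_pairI)
  have nz: "?b a \<noteq> 0 \<or> ?c a \<noteq> 0" if "a \<noteq> (0, 0)" for a
  proof (rule ccontr)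
    assume *: "\<not> ?thesis"
    have "?g a \<noteq> 0" using forms.independent_pair[OF q(1,2), of "fst a" "snd a"] that
      by (auto simp: prod_eq_iff)
    then obtain v where v: "v \<in> d" "?g a v \<noteq> 0"
      using pencil_line_not_in_conic[OF assms(1,6,7) gF] by blast
    obtain x y where "v = x *s p + y *s u" using v(1) unfolding u(3) by (rule plane.span_pairE)
    then show False using v(2) * g[of a x y] by simp
  qed
  \<comment> \<open>This is the determinant of the map sending \<open>a\<close> to
    (\<open>?c a\<close>, \<open>- ?b a\<close>). At (b2, -b1) the form \<open>?b\<close> is zero
    and \<open>?c\<close> is the determinant up to sign; at (q2 u, -q1 u) the roles are exchanged.
    If the determinant were zero, \<open>nz\<close> would make both pairs zero, and then
    \<open>nz\<close> fails at (1, 0).\<close>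
  have det: "q1 u * (- b2) - q2 u * (- b1) \<noteq> 0"
  proof
    assume 0: "q1 u * (- b2) - q2 u * (- b1) = 0"
    have "(b2, - b1) = (0, 0)"
      by (rule ccontr, drule nz) (use 0 in \<open>auto simp: algebra_simps\<close>)
    moreover have "(q2 u, - q1 u) = (0, 0)"
      by (rule ccontr, drule nz) (use 0 in \<open>auto simp: algebra_simps\<close>)
    ultimately show False using nz[of "(1, 0)"] by simp
  qed

  \<comment> \<open>The second intersection, with its coefficients arranged as matrix rows to match
    \<open>cross_ratio_linear\<close>.\<close>
  define \<phi> where "\<phi> x = vec.span {(q1 u * fst x + q2 u * snd x) *s p
    + (- b1 * fst x + - b2 * snd x) *s u}" for x
  have conic: "\<exists>a. \<Gamma> = forms.span {?g a} \<and> a \<noteq> (0, 0) \<and> second_intersection P d \<Gamma> = \<phi> a"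
    if "\<Gamma> \<in> pencil_conics \<F>" for \<Gamma>
  proof -
    obtain h where h: "\<Gamma> = forms.span {h}" "h \<in> \<F>" "h \<noteq> 0"
      using \<open>\<Gamma> \<in> pencil_conics \<F>\<close> by (auto simp: forms.projective_points_def)
    obtain s t where "h = form_scale s q1 + form_scale t q2"
      using h(2) unfolding q(3) by (rule forms.span_pairE)
    then have a: "h = ?g (s, t)" "(s, t) \<noteq> (0, 0)" using h(3) by auto
    have "second_intersection P d \<Gamma> = vec.span {?c (s, t) *s p + (- ?b (s, t)) *s u}"
      unfolding p(1) h(1) a(1)
      by (rule second_intersection_eq[OF _ u assms(6) g nz[OF a(2)]]) (use gF F(1) in blast)
    also have "\<dots> = \<phi> (s, t)" by (simp add: \<phi>_def algebra_simps)
    finally show ?thesis using h(1) a by blast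
  qed
  obtain a where a: "\<Gamma>\<^sub>1 = forms.span {?g a}" "a \<noteq> (0, 0)" "M\<^sub>1 = \<phi> a"
    using conic[OF assms(2)] assms(8) by blast
  obtain b where b: "\<Gamma>\<^sub>2 = forms.span {?g b}" "b \<noteq> (0, 0)" "M\<^sub>2 = \<phi> b"
    using conic[OF assms(3)] assms(9) by blast
  obtain c where c: "\<Gamma>\<^sub>3 = forms.span {?g c}" "c \<noteq> (0, 0)" "M\<^sub>3 = \<phi> c"
    using conic[OF assms(4)] assms(10) by blast
  obtain e where e: "\<Gamma>\<^sub>4 = forms.span {?g e}" "e \<noteq> (0, 0)" "M\<^sub>4 = \<phi> e"
    using conic[OF assms(5)] assms(11) by blast
  show ?thesis
    unfolding a(3) b(3) c(3) e(3) \<phi>_def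
    by (rule forms.cross_ratio_linear[OF plane.projective_space_axioms q(1,2) u(1,2) det
          a(1,2) b(1,2) c(1,2) e(1,2)])
qed

end
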